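(* Let $U_n$, $n=1,2,\ldots$, be a sequence of linear operators $$U_nf(x)=\int_a^bK_n(x,t)f(t)\,dt,\qquad |K_n(x,t)|\le M_n,$$ having the localization property ($L$-property). Then for any set $E\subset[a,b]$ of Lebesgue measure zero there exists a (Lebesgue measurable) set $G\subset[a,b]$ such that $$\liminf_{n\to\infty}U_n\mathbb{I}_G(x)\le 0,\qquad \limsup_{n\to\infty}U_n\mathbb{I}_G(x)\ge 1\qquad\text{for any } x\in E,$$ where $\mathbb{I}_G$ denotes the characteristic function of $G$.
   Context: $[a,b]$ is a bounded closed interval of the real line. For each $n\in\mathbb{N}$ the kernel $K_n:[a,b]\times[a,b]\to\mathbb{R}$ is measurable in $t$ and satisfies $|K_n(x,t)|\le M_n$ for some finite constant $M_n$ depending only on $n$. The operators $U_nf(x)=\int_a^bK_n(x,t)f(t)\,dt$ are defined for $f\in L^1(a,b)$ and $x\in[a,b]$. Localization property ($L$-property): the sequence $(U_n)$ has the localization property if for any interval $I=(\alpha,\beta)\subset[a,b]$ and any function $f\in L^1(a,b)$ with $f(x)=1$ for $x\in I$, one has $\lim_{n\to\infty}U_nf(x)=1$ for $x\in I$, and the convergence is uniform on each closed set $A\subset I$.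
   Formalization: If E contains the endpoint a (resp. b), the formal theorem also assumes the localization property on the intervals [a,β) (resp. (α,b]) in [a,b]; without this the claim fails, e.g. for E={a} and K_n(a,t)=0. For E inside (a,b) nothing is added. *)

theory Defs
  imports "HOL-Analysis.Analysis"
begin

definition kernel_op :: "(nat \<Rightarrow> real \<Rightarrow> real \<Rightarrow> real) \<Rightarrow> real \<Rightarrow> real \<Rightarrow> nat \<Rightarrow> (real \<Rightarrow> real) \<Rightarrow> real \<Rightarrow> real"
  where "kernel_op K a b n f x = (LINT t|lebesgue_on {a..b}. K n x t * f t)"

definition bounded_kernels :: "(nat \<Rightarrow> real \<Rightarrow> real \<Rightarrow> real) \<Rightarrow> real \<Rightarrow> real \<Rightarrow> (nat \<Rightarrow> real) \<Rightarrow> bool"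
  where "bounded_kernels K a b M \<longleftrightarrow>
    (\<forall>n. \<forall>x\<in>{a..b}. K n x \<in> borel_measurable (lebesgue_on {a..b}) \<and>
           (\<forall>t\<in>{a..b}. \<bar>K n x t\<bar> \<le> M n))"

definition localizes_on :: "(nat \<Rightarrow> real \<Rightarrow> real \<Rightarrow> real) \<Rightarrow> real \<Rightarrow> real \<Rightarrow> real set \<Rightarrow> bool"
  where "localizes_on K a b I \<longleftrightarrow>
    (\<forall>f. integrable (lebesgue_on {a..b}) f \<longrightarrow> (\<forall>x\<in>I. f x = 1) \<longrightarrow>
       (\<forall>x\<in>I. (\<lambda>n. kernel_op K a b n f x) \<longlonglongrightarrow> 1) \<and>
       (\<forall>A. closed A \<longrightarrow> A \<subseteq> I \<longrightarrow>
          uniform_limit A (\<lambda>n. kernel_op K a b n f) (\<lambda>x. 1) sequentially))"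

definition L_property :: "(nat \<Rightarrow> real \<Rightarrow> real \<Rightarrow> real) \<Rightarrow> real \<Rightarrow> real \<Rightarrow> bool"
  where "L_property K a b \<longleftrightarrow>
    (\<forall>\<alpha> \<beta>. {\<alpha><..<\<beta>} \<subseteq> {a..b} \<longrightarrow> localizes_on K a b {\<alpha><..<\<beta>})"

(* An open interval contained in [a,b] never contains a or b, so L_property says nothing about
   the values at the endpoints: K n a t = 0 for all n and t is compatible with it, and then no G
   has limsup >= 1 at a.  When a null set contains an endpoint, localization must therefore
   also be understood there, that is, for the relatively open intervals [a,\<beta>) or (\<alpha>,b].
   For null sets inside the open interval (a,b) this condition is vacuous. *)
definition L_property_at_endpoints_in :: "real set \<Rightarrow> (nat \<Rightarrow> real \<Rightarrow> real \<Rightarrow> real) \<Rightarrow> real \<Rightarrow> real \<Rightarrow> bool"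
  where "L_property_at_endpoints_in E K a b \<longleftrightarrow>
    (a \<in> E \<longrightarrow> (\<forall>\<beta>. {a..<\<beta>} \<subseteq> {a..b} \<longrightarrow> localizes_on K a b {a..<\<beta>})) \<and>
    (b \<in> E \<longrightarrow> (\<forall>\<alpha>. {\<alpha><..b} \<subseteq> {a..b} \<longrightarrow> localizes_on K a b {\<alpha><..b}))"

end

theory Submission
  imports Defs
begin

text \<open>
  The set G is a limit of finite symmetric differences of thin open sets containing parts of E.
  Suppose that a stage H of the construction is constant near a compact set A. By localization there
  is an N such that U_N applied to the indicator of H is within a prescribed error of that constant
  on all of A. Since the kernel with index N is bounded, later changes of total measure much smaller
  than 1/M_N do not destroy this. Now flip H on a thin open set V inside A which contains the part of
  E in the interior of A, so that the points of E in V have to be treated again with the opposite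
  constant. The set V need not be compact, but the part of E in V is covered by the interiors of
  countably many pairwise disjoint compact subsets of V. These pieces form a tree, whose nodes are
  processed one at a time; every point of E lies in pieces of all depths, and the constant alternates
  with the depth.

  The compact pieces are the level sets of the function measuring the part of a half-line outside
  a thin open cover W of E. Pairwise disjointness is what makes H constant in a whole neighbourhood
  of a piece when its turn comes: two pieces with a common endpoint would destroy uniformity.
\<close>

subsection \<open>Covering a null set by disjoint compact sets\<close>

lemma null_set_open_cover_antimono:
  fixes E :: "real set"
  assumes "E \<in> null_sets lebesgue"
  obtains W where "\<And>n. open (W n)" "\<And>n. E \<subseteq> W n" "antimono W"
    "\<And>n. emeasure lebesgue (W n) < ennreal (1 / Suc n)"
proof -
  have "\<exists>T. open T \<and> E \<subseteq> T \<and> emeasure lebesgue T < ennreal (1 / Suc n)" for n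
  proof -
    obtain T where T: "open T" "E \<subseteq> T" "T - E \<in> lmeasurable"
        "emeasure lebesgue (T - E) < ennreal (1 / Suc n)"
      using sets_lebesgue_outer_open[of E "1 / Suc n"] assms by auto
    have "emeasure lebesgue (T - E) = emeasure lebesgue T"
      using T(1) by (intro emeasure_Diff_null_set assms) auto
    with T show ?thesis by auto
  qed
  then obtain T where T: "\<And>n. open (T n)" "\<And>n. E \<subseteq> T n"
      "\<And>n. emeasure lebesgue (T n) < ennreal (1 / Suc n)"
    by metis
  show thesis
  proof
    show "open (\<Inter>i\<le>n. T i)" for n using T by auto
    show "E \<subseteq> (\<Inter>i\<le>n. T i)" for n using T by auto
    show "antimono (\<lambda>n. \<Inter>i\<le>n. T i)"
      by (rule antimonoI) (meson INT_anti_mono atMost_subset_iff order_refl)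
    show "emeasure lebesgue (\<Inter>i\<le>n. T i) < ennreal (1 / Suc n)" for n
    proof -
      have "emeasure lebesgue (\<Inter>i\<le>n. T i) \<le> emeasure lebesgue (T n)"
        using T by (intro emeasure_mono) auto
      then show ?thesis using T(3)[of n] by (rule le_less_trans)
    qed
  qed
qed

text \<open>
  The last property keeps the level sets in the next lemma away from the boundary of V.
\<close>

lemma null_set_thin_open_cover:
  fixes E V :: "real set"
  assumes "E \<in> null_sets lebesgue" "open V" "V \<noteq> UNIV"
  obtains W where "open W" "W \<subseteq> V" "E \<inter> V \<subseteq> W"
    "\<And>x y z. x < y \<Longrightarrow> z \<in> {x..y} \<Longrightarrow> z \<notin> V \<Longrightarrow> emeasure lebesgue (W \<inter> {x..y}) < ennreal (y - x)"
proof -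
  obtain T where T: "\<And>n. open (T n)" "\<And>n. E \<subseteq> T n" "antimono T"
    "\<And>n. emeasure lebesgue (T n) < ennreal (1 / Suc n)"
    using null_set_open_cover_antimono[OF assms(1)] by blast
  \<comment> \<open>Where the distance \<open>d\<close> to the complement of \<open>V\<close> is
    small, \<open>W\<close> draws only on \<open>T n\<close> with large \<open>n\<close>, so it gets
    thinner towards the boundary. A nonempty complement matters here: \<open>infdist\<close> to the
    empty set is 0 by default.\<close>
  define d where "d x = infdist x (- V)" for x
  define W where "W = (\<Union>n. T n \<inter> {x. 1 / Suc n < d x})"
  have d0: "d x > 0 \<longleftrightarrow> x \<in> V" for x
  proof -
    have "closed (- V)" "- V \<noteq> {}" using assms by auto
    then have "d x = 0 \<longleftrightarrow> x \<in> - V"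
      unfolding d_def by (metis in_closed_iff_infdist_zero)
    moreover have "d x \<ge> 0" by (simp add: d_def infdist_nonneg)
    ultimately show ?thesis by auto
  qed
  show thesis
  proof
    have "continuous_on UNIV d" unfolding d_def by (intro continuous_intros)
    then have "open {x. 1 / Suc n < d x}" for n
      by (intro open_Collect_less continuous_intros) auto
    then show "open W" unfolding W_def using T by auto
    show "W \<subseteq> V"
    proof
      fix x assume "x \<in> W"
      then obtain n where "1 / real (Suc n) < d x" by (auto simp: W_def)
      moreover have "1 / real (Suc n) > 0" by simp
      ultimately show "x \<in> V" using d0[of x] by linarith
    qed
    show "E \<inter> V \<subseteq> W"
    proof
      fix x assume "x \<in> E \<inter> V"
      then show "x \<in> W" unfolding W_def
        using d0[of x] T(2) reals_Archimedean[of "d x"] by (fastforce simp: inverse_eq_divide)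
    qed
    show "emeasure lebesgue (W \<inter> {x..y}) < ennreal (y - x)"
      if "x < y" "z \<in> {x..y}" "z \<notin> V" for x y z
    proof -
      \<comment> \<open>A point \<open>w\<close> of \<open>W\<close> in the interval is within
        \<open>y - x\<close> of \<open>z\<close>, which is outside \<open>V\<close>; so it comes
        from some \<open>T n\<close> with 1/(n+1) < y - x. The least such index gives the largest of
        these sets, whose measure is still below y - x.\<close>
      define k where "k = (LEAST n. 1 / real (Suc n) < y - x)"
      have k: "1 / real (Suc k) < y - x"
        unfolding k_def by (rule LeastI_ex)
          (use that(1) reals_Archimedean[of "y - x"] in \<open>simp add: inverse_eq_divide\<close>)
      have "W \<inter> {x..y} \<subseteq> T k"
      proof
        fix w assume "w \<in> W \<inter> {x..y}"
        then obtain n where n: "w \<in> T n" "1 / real (Suc n) < d w" "w \<in> {x..y}" by (auto simp: W_def)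
        have "d w \<le> dist w z" unfolding d_def using that by (intro infdist_le) auto
        also have "\<dots> \<le> y - x" using n that by (auto simp: dist_real_def)
        finally have "1 / real (Suc n) < y - x" using n by linarith
        then have "k \<le> n" unfolding k_def by (rule Least_le)
        then show "w \<in> T k" using T(3) n(1) by (auto dest: antimonoD)
      qed
      then have "emeasure lebesgue (W \<inter> {x..y}) \<le> emeasure lebesgue (T k)"
        using T by (intro emeasure_mono) auto
      also have "\<dots> < ennreal (1 / Suc k)" by (rule T)
      also have "\<dots> \<le> ennreal (y - x)" using k by (intro ennreal_leI) simp
      finally show ?thesis .
    qed
  qed
qed

text \<open>\<open>F\<close> increases over an interval by the measure of its part outside
  \<open>W\<close>. Hence it is constant near each point of \<open>W\<close>, which is therefore
  interior to its level set. Every level set with nonempty interior contains a rational, so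
  countably many suffice.\<close>

lemma disjoint_compact_cover:
  fixes E V :: "real set"
  assumes E: "E \<in> null_sets lebesgue" and V: "open V" "bounded V"
  shows "\<exists>C :: nat \<Rightarrow> real set. (\<forall>j. compact (C j) \<and> C j \<subseteq> V) \<and>
    (\<forall>i j. i \<noteq> j \<longrightarrow> C i \<inter> C j = {}) \<and> E \<inter> V \<subseteq> (\<Union>j. interior (C j))"
proof -
  obtain l r where lr: "V \<subseteq> {l<..<r}"
    using bounded_subset_box_symmetric[OF V(2)] by (metis box_real(1))
  have "V \<noteq> UNIV" using V(2) by auto
  with E V obtain W where W: "open W" "W \<subseteq> V" "E \<inter> V \<subseteq> W"
    "\<And>x y z. x < y \<Longrightarrow> z \<in> {x..y} \<Longrightarrow> z \<notin> V \<Longrightarrow> emeasure lebesgue (W \<inter> {x..y}) < ennreal (y - x)"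
    using null_set_thin_open_cover by metis
  define F where "F x = measure lebesgue ({l..x} - W)" for x
  have lm: "{x..y} - W \<in> lmeasurable" "{x..y} \<inter> W \<in> lmeasurable" for x y
    using W(1) by (auto intro!: fmeasurable_Diff fmeasurable_Int_fmeasurable)
  have F_diff: "F y - F x = y - x - measure lebesgue (W \<inter> {x..y})" if "l \<le> x" "x \<le> y" for x y
  proof -
    have "{l..y} - W = ({l..x} - W) \<union> ({x..y} - W)" using that by auto
    moreover have "negligible (({l..x} - W) \<inter> ({x..y} - W))"
      by (rule negligible_subset[of "{x}"]) auto
    ultimately have "F y = F x + measure lebesgue ({x..y} - W)"
      unfolding F_def by (metis lm(1) measure_negligible_finite_Union measure_Un3 negligible_imp_measure0 diff_zero)
    moreover have "measure lebesgue ({x..y} - W) = measure lebesgue {x..y} - measure lebesgue ({x..y} \<inter> W)"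
    proof -
      have "{x..y} - W = {x..y} - ({x..y} \<inter> W)" by auto
      then show ?thesis using lm by (metis Int_lower1 measurable_measure_Diff lmeasurable_interval(1) box_real(2) lmeasurable_cbox fmeasurableD)
    qed
    ultimately show ?thesis using that by (simp add: Int_commute)
  qed
  have le: "measure lebesgue (W \<inter> {x..y}) \<le> y - x" if "x \<le> y" for x y
    using measure_mono_fmeasurable[of "W \<inter> {x..y}" "{x..y}" lebesgue] lm(2)[of x y] that
    by (auto simp: Int_commute)
  have cont: "continuous_on {l..r} F"
  proof (rule continuous_onI)
    fix x e :: real assume x: "x \<in> {l..r}" "e > 0"
    have "dist (F y) (F x) \<le> e" if "y \<in> {l..r}" "dist y x < e" for y
      using that x F_diff[of x y] F_diff[of y x] le[of x y] le[of y x]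
        measure_nonneg[of lebesgue "W \<inter> {x..y}"] measure_nonneg[of lebesgue "W \<inter> {y..x}"]
      by (cases "x \<le> y") (auto simp: dist_real_def simp del: measure_nonneg)
    then show "\<exists>d>0. \<forall>y\<in>{l..r}. dist y x < d \<longrightarrow> dist (F y) (F x) \<le> e" using x by blast
  qed
  define L where "L t = {y \<in> {l..r}. F y = t}" for t
  have L_compact: "compact (L t)" for t
  proof -
    have "closedin (top_of_set {l..r}) (L t)"
      using continuous_closedin_preimage_constant[OF cont] by (simp add: L_def)
    then show ?thesis by (rule closedin_compact[rotated]) simp
  qed
  \<comment> \<open>If a level contained a point of \<open>W\<close> and a point \<open>z\<close>
    outside \<open>V\<close>, then \<open>W\<close> would have full measure in the interval between
    them, against its thinness.\<close>
  have L_sub: "L t \<subseteq> V" if "x \<in> W" "x \<in> L t" for x t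
  proof
    fix z assume z: "z \<in> L t"
    show "z \<in> V"
    proof (rule ccontr)
      assume nz: "z \<notin> V"
      then have "z \<noteq> x" using that(1) W(2) by auto
      define p q where "p = min x z" and "q = max x z"
      have pq: "l \<le> p" "p < q" "z \<in> {p..q}" "F q = F p"
        using that z \<open>z \<noteq> x\<close> by (auto simp: p_def q_def L_def min_def max_def)
      have "emeasure lebesgue (W \<inter> {p..q}) < ennreal (q - p)"
        using W(4) pq nz by blast
      then have "measure lebesgue (W \<inter> {p..q}) < q - p"
        using lm(2)[of p q] pq by (simp add: Int_commute emeasure_eq_measure2 ennreal_less_iff)
      then show False using F_diff[of p q] pq by simp
    qed
  qed
  have L_int: "x \<in> interior (L (F x))" if x: "x \<in> W" for x
  proof -
    obtain e where e: "e > 0" "ball x e \<subseteq> W" using W(1) x by (rule openE)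
    then have ball_lr: "ball x e \<subseteq> {l<..<r}" using W(2) lr by (meson subset_trans)
    have "F y = F x" if y: "y \<in> ball x e" for y
    proof -
      define p q where "p = min x y" and "q = max x y"
      have "{p..q} \<subseteq> ball x e" using y by (auto simp: p_def q_def dist_real_def)
      then have "W \<inter> {p..q} = {p..q}" using e by auto
      moreover have "l \<le> p" "p \<le> q"
        using subsetD[OF ball_lr y] subsetD[OF ball_lr, of x] e(1) by (auto simp: p_def q_def)
      ultimately have "F q = F p" using F_diff[of p q] by simp
      then show ?thesis by (auto simp: p_def q_def min_def max_def split: if_splits)
    qed
    moreover have "ball x e \<subseteq> {l..r}" using ball_lr by (auto dest!: subsetD)
    ultimately have "ball x e \<subseteq> L (F x)" by (auto simp: L_def)
    then show ?thesis using e(1) by (meson centre_in_ball interior_maximal open_ball subsetD)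
  qed
  define q where "q = (\<lambda>j. real_of_rat (from_nat j))"
  \<comment> \<open>Levels are listed through the values of \<open>F\<close> at the rationals. Only
    the first occurrence of a value is kept, for disjointness; repetitions and levels leaving
    \<open>V\<close> become the empty set.\<close>
  define C where "C j = (if L (F (q j)) \<subseteq> V \<and> (\<forall>i<j. F (q i) \<noteq> F (q j)) then L (F (q j)) else {})" for j
  show ?thesis
  proof (intro exI conjI allI impI)
    show "compact (C j)" "C j \<subseteq> V" for j using L_compact by (auto simp: C_def)
    show "C i \<inter> C j = {}" if "i \<noteq> j" for i j
      using that by (cases i j rule: linorder_cases) (auto simp: C_def L_def)
    show "E \<inter> V \<subseteq> (\<Union>j. interior (C j))"
    proof
      fix x assume "x \<in> E \<inter> V"
      then have x: "x \<in> W" using W(3) by auto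
      obtain e where e: "e > 0" "ball x e \<subseteq> interior (L (F x))"
        using open_interior L_int[OF x] by (rule openE)
      obtain s where "x < of_rat s" "of_rat s < x + e"
        using of_rat_dense[of x "x + e"] e(1) by auto
      then have "of_rat s \<in> interior (L (F x))"
        using e(2) by (auto simp: dist_real_def subset_iff)
      then have "F (q (to_nat s)) = F x" using interior_subset by (force simp: q_def L_def)
      then have ex: "\<exists>j. F (q j) = F x" by blast
      define j where "j = (LEAST j. F (q j) = F x)"
      have "F (q j) = F x" unfolding j_def using LeastI_ex[OF ex] .
      moreover have "\<forall>i<j. F (q i) \<noteq> F x" unfolding j_def using not_less_Least by blast
      moreover have "L (F x) \<subseteq> V" using L_sub[OF x] interior_subset L_int[OF x] by blast
      ultimately have "C j = L (F x)" by (simp add: C_def)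
      then show "x \<in> (\<Union>j. interior (C j))" using L_int[OF x] by (metis UN_I UNIV_I)
    qed
  qed
qed

subsection \<open>Uniform localization\<close>

lemma bounded_kernels_abs_le:
  assumes "bounded_kernels K a b M" "x \<in> {a..b}" "t \<in> {a..b}"
  shows "\<bar>K n x t\<bar> \<le> \<bar>M n\<bar>"
proof -
  have "\<bar>K n x t\<bar> \<le> M n" using assms unfolding bounded_kernels_def by blast
  then show ?thesis by linarith
qed

lemma integrable_kernel_mult:
  assumes "bounded_kernels K a b M" "x \<in> {a..b}" "integrable (lebesgue_on {a..b}) f"
  shows "integrable (lebesgue_on {a..b}) (\<lambda>t. K n x t * f t)"
proof (rule Bochner_Integration.integrable_bound)
  show "integrable (lebesgue_on {a..b}) (\<lambda>t. M n * f t)" using assms by simp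
  show "(\<lambda>t. K n x t * f t) \<in> borel_measurable (lebesgue_on {a..b})"
    using assms by (auto simp: bounded_kernels_def intro!: borel_measurable_times)
  have "\<bar>K n x t * f t\<bar> \<le> \<bar>M n * f t\<bar>" if "t \<in> {a..b}" for t
  proof -
    have "\<bar>K n x t\<bar> \<le> \<bar>M n\<bar>"
      using bounded_kernels_abs_le assms(1,2) that by blast
    then show ?thesis by (simp add: abs_mult mult_right_mono)
  qed
  then show "AE t in lebesgue_on {a..b}. norm (K n x t * f t) \<le> norm (M n * f t)"
    by (intro AE_I2) auto
qed

lemma kernel_op_diff:
  assumes "bounded_kernels K a b M" "x \<in> {a..b}"
    "integrable (lebesgue_on {a..b}) f" "integrable (lebesgue_on {a..b}) g"
  shows "kernel_op K a b n (\<lambda>t. f t - g t) x = kernel_op K a b n f x - kernel_op K a b n g x"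
  using integrable_kernel_mult[OF assms(1,2,3)] integrable_kernel_mult[OF assms(1,2,4)]
  by (simp add: kernel_op_def right_diff_distrib)

lemma integrable_indicator_interval:
  assumes "S \<in> sets lebesgue"
  shows "integrable (lebesgue_on {a..b}) (indicator S :: real \<Rightarrow> real)"
proof (rule Bochner_Integration.integrable_bound)
  show "integrable (lebesgue_on {a..b}) (\<lambda>_. 1::real)"
    by (simp add: lmeasurable_iff_integrable[symmetric] integrable_restrict_space)
  show "(indicator S :: real \<Rightarrow> real) \<in> borel_measurable (lebesgue_on {a..b})"
    using assms by (intro measurable_restrict_space1) auto
qed (auto simp: indicator_def)

text \<open>The indicators differ by at most 1 and only on \<open>R\<close>, so the kernel bound
  times the measure of \<open>R\<close> controls the integral. This is the price of all later
  flips.\<close>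

lemma kernel_op_indicator_dist:
  assumes K: "bounded_kernels K a b M" "x \<in> {a..b}"
    and S: "S \<in> sets lebesgue" "T \<in> sets lebesgue"
    and R: "R \<in> sets lebesgue" "\<And>t. t \<notin> R \<Longrightarrow> t \<in> S \<longleftrightarrow> t \<in> T" "emeasure lebesgue R \<le> ennreal r" "r \<ge> 0"
  shows "\<bar>kernel_op K a b n (indicator S) x - kernel_op K a b n (indicator T) x\<bar> \<le> \<bar>M n\<bar> * r"
proof -
  let ?L = "lebesgue_on {a..b}"
  let ?d = "\<lambda>t. indicator S t - indicator T t :: real"
  note iS = integrable_indicator_interval[OF S(1), of a b]
  note iT = integrable_indicator_interval[OF S(2), of a b]
  note iR = integrable_indicator_interval[OF R(1), of a b]
  have "\<bar>kernel_op K a b n (indicator S) x - kernel_op K a b n (indicator T) x\<bar> = \<bar>LINT t|?L. K n x t * ?d t\<bar>"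
    using kernel_op_diff[OF K iS iT] by (simp add: kernel_op_def)
  also have "\<dots> \<le> (LINT t|?L. \<bar>K n x t * ?d t\<bar>)" by (rule integral_abs_bound)
  also have "\<dots> \<le> (LINT t|?L. \<bar>M n\<bar> * indicator R t)"
  proof (rule integral_mono)
    show "integrable ?L (\<lambda>t. \<bar>K n x t * ?d t\<bar>)"
      using iS iT by (intro integrable_abs integrable_kernel_mult[OF K]) auto
    show "integrable ?L (\<lambda>t. \<bar>M n\<bar> * indicator R t)" using iR by auto
    fix t assume "t \<in> space ?L"
    then have "\<bar>K n x t\<bar> \<le> \<bar>M n\<bar>"
      using bounded_kernels_abs_le[OF K] by simp
    then show "\<bar>K n x t * ?d t\<bar> \<le> \<bar>M n\<bar> * indicator R t"
      using R(2)[of t] by (auto simp: indicator_def)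
  qed
  also have "\<dots> = \<bar>M n\<bar> * measure lebesgue (R \<inter> {a..b})"
    using R(1) by (simp add: measure_restrict_space sets_restrict_space_iff Int_commute)
  also have "\<dots> \<le> \<bar>M n\<bar> * r"
  proof -
    have "emeasure lebesgue (R \<inter> {a..b}) \<le> ennreal r"
      using emeasure_mono[OF Int_lower1 R(1)] R(3) by (rule order_trans)
    then show ?thesis using R(4) by (intro mult_left_mono) (simp_all add: measure_def enn2real_leI)
  qed
  finally show ?thesis .
qed

text \<open>A small ball around \<open>x\<close> meets [a,b] in an open interval or in one that is
  half-open at \<open>a\<close> or at \<open>b\<close>. The endpoint condition covers the half-open
  ones because such an \<open>x\<close> is in \<open>E\<close>.\<close>

lemma localization_at_point:
  assumes ab: "a < b" and L: "L_property K a b" "L_property_at_endpoints_in E K a b"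
    and x: "x \<in> {a..b}" "x = a \<or> x = b \<Longrightarrow> x \<in> E"
    and Q: "open Q" "x \<in> Q"
    and f: "integrable (lebesgue_on {a..b}) f" "\<And>t. t \<in> Q \<Longrightarrow> f t = 1"
  shows "\<exists>T. open T \<and> x \<in> T \<and> uniform_limit (T \<inter> {a..b}) (\<lambda>n. kernel_op K a b n f) (\<lambda>x. 1) sequentially"
proof -
  obtain e0 where e0: "e0 > 0" "ball x e0 \<subseteq> Q" using Q open_contains_ball by blast
  \<comment> \<open>\<open>e\<close> is at most the distance to each endpoint other than
    \<open>x\<close>; for an endpoint equal to \<open>x\<close> that distance is 0 and
    \<open>b - a\<close> stands in.\<close>
  define e where "e = min e0 (min (if x = a then b - a else x - a) (if x = b then b - a else b - x))"
  have e: "e > 0" "e \<le> e0" "x = a \<or> a \<le> x - e" "x = b \<or> x + e \<le> b" "e \<le> b - a"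
    using e0 x ab by (auto simp: e_def)
  define I where "I = ball x e \<inter> {a..b}"
  have "localizes_on K a b I"
  proof -
    consider "x = a" | "x = b" | "x \<noteq> a" "x \<noteq> b" by blast
    then show ?thesis
    proof cases
      case 1
      then have "I = {a..<a+e}" using e by (auto simp: I_def dist_real_def)
      moreover have "{a..<a+e} \<subseteq> {a..b}" using e(5) by auto
      ultimately show ?thesis using 1 L(2) x unfolding L_property_at_endpoints_in_def by blast
    next
      case 2
      then have "I = {b-e<..b}" using e by (auto simp: I_def dist_real_def)
      moreover have "{b-e<..b} \<subseteq> {a..b}" using e(5) by auto
      ultimately show ?thesis using 2 L(2) x unfolding L_property_at_endpoints_in_def by blast
    next
      case 3
      then have "I = {x-e<..<x+e}" using e by (auto simp: I_def dist_real_def)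
      moreover have "{x-e<..<x+e} \<subseteq> {a..b}" using 3 e by auto
      ultimately show ?thesis using L(1) unfolding L_property_def by metis
    qed
  qed
  moreover have "I \<subseteq> Q" using e(2) e0(2) by (auto simp: I_def)
  then have "\<forall>t\<in>I. f t = 1" using f(2) by blast
  moreover have "closed (cball x (e/2) \<inter> {a..b})" "cball x (e/2) \<inter> {a..b} \<subseteq> I"
    using e by (auto simp: I_def)
  ultimately have "uniform_limit (cball x (e/2) \<inter> {a..b}) (\<lambda>n. kernel_op K a b n f) (\<lambda>x. 1) sequentially"
    using f(1) unfolding localizes_on_def by blast
  then have "uniform_limit (ball x (e/2) \<inter> {a..b}) (\<lambda>n. kernel_op K a b n f) (\<lambda>x. 1) sequentially"
    by (rule uniform_limit_on_subset) auto
  then show ?thesis using e(1) by (intro exI[of _ "ball x (e/2)"]) auto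
qed

text \<open>Localization is assumed for intervals only. Finitely many of the neighbourhoods from
  \<open>localization_at_point\<close> cover the part of \<open>A\<close> in [a,b], and uniform
  convergence passes to finite unions.\<close>

lemma localization_on_compact:
  assumes ab: "a < b" and L: "L_property K a b" "L_property_at_endpoints_in E K a b"
    and A: "compact A" "\<And>x. x \<in> A \<Longrightarrow> x = a \<or> x = b \<Longrightarrow> x \<in> E"
    and Q: "open Q" "A \<subseteq> Q"
    and f: "integrable (lebesgue_on {a..b}) f" "\<And>t. t \<in> Q \<Longrightarrow> f t = 1"
  shows "uniform_limit (A \<inter> {a..b}) (\<lambda>n. kernel_op K a b n f) (\<lambda>x. 1) sequentially"
proof -
  have "\<exists>T. open T \<and> x \<in> T \<and> uniform_limit (T \<inter> {a..b}) (\<lambda>n. kernel_op K a b n f) (\<lambda>x. 1) sequentially"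
    if "x \<in> A \<inter> {a..b}" for x
    using that A(2) Q by (intro localization_at_point[OF ab L _ _ Q(1) _ f]) auto
  then obtain T where T: "\<And>x. x \<in> A \<inter> {a..b} \<Longrightarrow> open (T x)" "\<And>x. x \<in> A \<inter> {a..b} \<Longrightarrow> x \<in> T x"
    "\<And>x. x \<in> A \<inter> {a..b} \<Longrightarrow> uniform_limit (T x \<inter> {a..b}) (\<lambda>n. kernel_op K a b n f) (\<lambda>x. 1) sequentially"
    by metis
  have "compact (A \<inter> {a..b})" using A(1) by (simp add: compact_Int_closed)
  then obtain D where D: "D \<subseteq> A \<inter> {a..b}" "finite D" "A \<inter> {a..b} \<subseteq> (\<Union>x\<in>D. T x)"
    using T(1,2) by (elim compactE_image[where C = "A \<inter> {a..b}" and f = T]) auto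
  have "uniform_limit (\<Union>x\<in>D. T x \<inter> {a..b}) (\<lambda>n. kernel_op K a b n f) (\<lambda>x. 1) sequentially"
    by (intro uniform_limit_on_UNION D(2) T(3)) (use D(1) in auto)
  then show ?thesis by (rule uniform_limit_on_subset) (use D in auto)
qed

lemma localization_indicator:
  assumes ab: "a < b" and K: "bounded_kernels K a b M"
    and L: "L_property K a b" "L_property_at_endpoints_in E K a b"
    and A: "compact A" "\<And>x. x \<in> A \<Longrightarrow> x = a \<or> x = b \<Longrightarrow> x \<in> E"
    and Q: "open Q" "A \<subseteq> Q"
    and S: "S \<in> sets lebesgue" "\<And>t. t \<in> Q \<Longrightarrow> t \<in> S \<longleftrightarrow> c"
  shows "uniform_limit (A \<inter> {a..b}) (\<lambda>n. kernel_op K a b n (indicator S)) (\<lambda>x. of_bool c) sequentially"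
proof (cases c)
  case True
  then show ?thesis
    using localization_on_compact[OF ab L A Q integrable_indicator_interval[OF S(1)]] S(2) by auto
next
  case False
  \<comment> \<open>The property speaks of functions equal to 1. For the value 0, the indicator of
    \<open>S\<close> is written as the constant 1 minus the indicator of the complement; both
    localize to 1 on \<open>A\<close>.\<close>
  have C: "(indicator (- S) :: real \<Rightarrow> real) = (\<lambda>t. indicator UNIV t - indicator S t)"
    by (auto simp: indicator_def)
  have i: "integrable (lebesgue_on {a..b}) (indicator UNIV :: real \<Rightarrow> real)"
    "integrable (lebesgue_on {a..b}) (indicator (- S) :: real \<Rightarrow> real)"
    using S(1) by (auto intro!: integrable_indicator_interval simp: Compl_in_sets_lebesgue)
  have "uniform_limit (A \<inter> {a..b}) (\<lambda>n. kernel_op K a b n (indicator UNIV)) (\<lambda>x. 1) sequentially"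
    using A Q by (intro localization_on_compact[OF ab L A Q i(1)]) auto
  moreover have "uniform_limit (A \<inter> {a..b}) (\<lambda>n. kernel_op K a b n (indicator (- S))) (\<lambda>x. 1) sequentially"
    using A Q S(2) False by (intro localization_on_compact[OF ab L A Q i(2)]) auto
  ultimately have "uniform_limit (A \<inter> {a..b}) (\<lambda>n x. kernel_op K a b n (indicator UNIV) x - kernel_op K a b n (indicator (- S)) x)
      (\<lambda>x. 1 - 1) sequentially"
    by (rule uniform_limit_minus)
  moreover have "kernel_op K a b n (indicator UNIV) x - kernel_op K a b n (indicator (- S)) x = kernel_op K a b n (indicator S) x"
    if "x \<in> A \<inter> {a..b}" for x n
    using kernel_op_diff[OF K _ i(1) integrable_indicator_interval[OF S(1)], of x n] that by (simp add: C)
  ultimately show ?thesis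
    using False by (subst uniform_limit_cong'[where g = "\<lambda>n x. kernel_op K a b n (indicator UNIV) x - kernel_op K a b n (indicator (- S)) x" and i = "\<lambda>x. 1 - 1"]) auto
qed

subsection \<open>The tree of pieces\<close>

lemma fst_prod_decode_le: "fst (prod_decode k) \<le> k"
  by (metis le_prod_encode_1 prod.collapse prod_decode_inverse)

text \<open>
  Nodes of the tree are numbered so that parents come first: node 0 is the root and the j-th child
  of node m has the number Suc (prod_encode (m, j)).
\<close>

function anc :: "nat \<Rightarrow> nat set" where
  "anc 0 = {}"
| "anc (Suc k) = insert (fst (prod_decode k)) (anc (fst (prod_decode k)))"
  by pat_completeness auto
termination
  by (relation less_than) (auto simp: less_Suc_eq_le fst_prod_decode_le)

text \<open>\<open>V m\<close> is the set flipped at node \<open>m\<close>. The piece of a node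
  depends on \<open>V\<close> only at its parent, so it is known before the node's own flip set is
  chosen.\<close>

fun piece :: "(real set \<Rightarrow> nat \<Rightarrow> real set) \<Rightarrow> real set \<Rightarrow> (nat \<Rightarrow> real set) \<Rightarrow> nat \<Rightarrow> real set" where
  "piece C U V 0 = U"
| "piece C U V (Suc k) = C (V (fst (prod_decode k))) (snd (prod_decode k))"

lemma piece_cong:
  assumes "\<And>m. m < n \<Longrightarrow> V m = V' m"
  shows "piece C U V n = piece C U V' n"
  using assms fst_prod_decode_le by (cases n) (auto simp: less_Suc_eq_le)

lemma anc_less: "m \<in> anc n \<Longrightarrow> m < n"
proof (induction n rule: less_induct)
  case (less n)
  show ?case
  proof (cases n)
    case 0
    then show ?thesis using less by simp
  next
    case (Suc k)
    then show ?thesis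
      using less fst_prod_decode_le[of k] by (auto simp: less_Suc_eq_le) (meson le_imp_less_Suc less_imp_le order_trans)
  qed
qed

lemma finite_anc: "finite (anc n)"
  using anc_less by (meson bounded_nat_set_is_finite)

lemma zero_in_anc: "n > 0 \<Longrightarrow> 0 \<in> anc n"
proof (induction n rule: less_induct)
  case (less n)
  then obtain k where k: "n = Suc k" using gr0_implies_Suc by blast
  then show ?case
    using less.IH[of "fst (prod_decode k)"] fst_prod_decode_le[of k] by (cases "fst (prod_decode k)") auto
qed

text \<open>The number of ancestors serves as the depth, whose parity decides the constant wanted on
  a piece.\<close>

lemma card_anc_Suc: "card (anc (Suc (prod_encode (m, j)))) = Suc (card (anc m))"
  using card_insert_disjoint[OF finite_anc, of m m] anc_less[of m m] by auto

lemma card_anc_le: "card (anc n) \<le> n"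
  using card_mono[of "{..<n}" "anc n"] anc_less by auto

lemma piece_ancestor:
  assumes C: "\<And>m j. m < n \<Longrightarrow> C (V m) j \<subseteq> V m"
    and V: "\<And>m. m < n \<Longrightarrow> V m \<subseteq> piece C U V m"
    and "m \<in> anc n"
  shows "piece C U V n \<subseteq> V m"
  using assms
proof (induction n rule: less_induct)
  case (less n)
  then obtain k where k: "n = Suc k" by (cases n) auto
  define p where "p = fst (prod_decode k)"
  have p: "p < n" using fst_prod_decode_le[of k] k by (simp add: p_def)
  have sub: "piece C U V n \<subseteq> V p" using less.prems(1)[OF p] by (simp add: k p_def)
  from less.prems(3) consider "m = p" | "m \<in> anc p" by (auto simp: k p_def)
  then show ?case
  proof cases
    case 2
    then have "piece C U V p \<subseteq> V m"
      using less.prems(1,2) p by (intro less.IH) auto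
    then show ?thesis using sub less.prems(2)[OF p] by blast
  qed (use sub in simp)
qed

text \<open>Climbing from two incomparable nodes ends at two different children of one node. With
  \<open>p\<close> the parent of \<open>n\<close>, the outer induction treats the pair
  \<open>p\<close>, \<open>m\<close>; if \<open>p\<close> is an ancestor of \<open>m\<close>, the
  inner induction moves \<open>m\<close> up to its parent until it is a sibling of
  \<open>n\<close>.\<close>

lemma piece_disjoint:
  assumes C: "\<And>m j. m < n \<Longrightarrow> C (V m) j \<subseteq> V m"
    and D: "\<And>m i j. m < n \<Longrightarrow> i \<noteq> j \<Longrightarrow> C (V m) i \<inter> C (V m) j = {}"
    and V: "\<And>m. m < n \<Longrightarrow> V m \<subseteq> piece C U V m"
    and "m < n" "m \<notin> anc n"
  shows "piece C U V n \<inter> piece C U V m = {}"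
  using assms
proof (induction n arbitrary: m rule: less_induct)
  case (less n)
  note IHn = less.IH and C = less.prems(1) and D = less.prems(2) and V = less.prems(3)
  show ?case using less.prems(4,5)
  proof (induction m rule: less_induct)
    case (less m)
    then obtain k where k: "n = Suc k" by (cases n) auto
    define p where "p = fst (prod_decode k)"
    have p: "p < n" using fst_prod_decode_le[of k] k by (simp add: p_def)
    have sub: "piece C U V n \<subseteq> V p" "piece C U V n \<subseteq> piece C U V p"
      using C[OF p] V[OF p] by (auto simp: k p_def)
    have m: "m \<noteq> p" "m \<notin> anc p" using less.prems by (auto simp: k p_def)
    show ?case
    proof (cases "m < p")
      case True
      then have "piece C U V p \<inter> piece C U V m = {}"
        using m p C D V by (intro IHn) auto
      then show ?thesis using sub by blast
    next
      case False
      then have pm: "p < m" using m by simp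
      show ?thesis
      proof (cases "p \<in> anc m")
        case False
        then have "piece C U V m \<inter> piece C U V p = {}"
          using pm less.prems C D V by (intro IHn) auto
        then show ?thesis using sub by blast
      next
        case True
        then obtain k' where k': "m = Suc k'" by (cases m) auto
        define q where "q = fst (prod_decode k')"
        have q: "q < m" using fst_prod_decode_le[of k'] k' by (simp add: q_def)
        show ?thesis
        proof (cases "q = p")
          case True
          then have "snd (prod_decode k) \<noteq> snd (prod_decode k')"
            using less.prems(1) k k' by (metis p_def q_def less_irrefl prod.collapse prod_decode_eq)
          then show ?thesis using D[OF p] True by (simp add: k k' p_def q_def)
        next
          case False
          then have "p \<in> anc q" using True by (auto simp: k' q_def)
          then have "p < q" by (rule anc_less)
          then have "q \<notin> anc n" using anc_less[of q p] by (auto simp: k p_def)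
          then have "piece C U V n \<inter> piece C U V q = {}"
            using less.IH[OF q] q less.prems by auto
          moreover have "piece C U V m \<subseteq> piece C U V q"
            using C[of q] V[of q] q less.prems(1) by (fastforce simp: k' q_def)
          ultimately show ?thesis by blast
        qed
      qed
    qed
  qed
qed

text \<open>The symmetric difference of the first \<open>n\<close> sets: the stage reached before
  node \<open>n\<close> is treated. Counting memberships lets its value be read off from which sets
  contain a point.\<close>

definition parity_set :: "(nat \<Rightarrow> 'a set) \<Rightarrow> nat \<Rightarrow> 'a set" where
  "parity_set V n = {x. odd (card {m. m < n \<and> x \<in> V m})}"

lemma parity_set_0: "parity_set V 0 = {}"
  by (simp add: parity_set_def)

lemma parity_set_Suc: "parity_set V (Suc n) = (parity_set V n - V n) \<union> (V n - parity_set V n)"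
proof -
  have "{m. m < Suc n \<and> x \<in> V m} = (if x \<in> V n then insert n {m. m < n \<and> x \<in> V m} else {m. m < n \<and> x \<in> V m})" for x
    by (auto simp: less_Suc_eq)
  then show ?thesis unfolding parity_set_def by auto
qed

lemma parity_set_cong:
  assumes "\<And>m. m < n \<Longrightarrow> V m = V' m"
  shows "parity_set V n = parity_set V' n"
proof -
  have "{m. m < n \<and> x \<in> V m} = {m. m < n \<and> x \<in> V' m}" for x
    using assms by auto
  then show ?thesis by (simp add: parity_set_def)
qed

lemma parity_set_borel:
  assumes "\<And>m. m < n \<Longrightarrow> open (V m)"
  shows "parity_set V n \<in> sets borel"
  using assms
  by (induction n) (auto simp: parity_set_0 parity_set_Suc)

text \<open>\<open>Q\<close> lies inside the flip sets of all ancestors and outside the pieces,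
  hence outside the flip sets, of all other earlier nodes. So a point of \<open>Q\<close> has been
  flipped exactly once per ancestor.\<close>

lemma piece_neighbourhood:
  assumes C: "\<And>m j. m < n \<Longrightarrow> C (V m) j \<subseteq> V m"
    and cmp: "\<And>m j. m < n \<Longrightarrow> compact (C (V m) j)"
    and D: "\<And>m i j. m < n \<Longrightarrow> i \<noteq> j \<Longrightarrow> C (V m) i \<inter> C (V m) j = {}"
    and V: "\<And>m. m < n \<Longrightarrow> V m \<subseteq> piece C U V m" and op: "\<And>m. m < n \<Longrightarrow> open (V m)"
    and "n > 0"
  obtains Q where "open Q" "piece C U V n \<subseteq> Q"
    "\<And>x. x \<in> Q \<Longrightarrow> x \<in> parity_set V n \<longleftrightarrow> odd (card (anc n))"
proof
  let ?Q = "(\<Inter>m\<in>anc n. V m) \<inter> (\<Inter>m\<in>{..<n} - anc n. - piece C U V m)"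
  have "closed (piece C U V m)" if m: "m \<in> {..<n} - anc n" for m
  proof -
    \<comment> \<open>The root is an ancestor of every \<open>n > 0\<close>, so \<open>m\<close> is
      a child of some node and has a compact piece; nothing makes the root's piece \<open>U\<close>
      closed.\<close>
    obtain k where k: "m = Suc k" using zero_in_anc[OF \<open>n > 0\<close>] m by (cases m) auto
    have "fst (prod_decode k) < n" using fst_prod_decode_le[of k] m k by auto
    then show ?thesis using cmp k compact_imp_closed by auto
  qed
  then show "open ?Q"
    using op anc_less finite_anc by (intro open_Int open_INT) (auto simp: open_Compl)
  show "piece C U V n \<subseteq> ?Q"
    using piece_ancestor[OF C V] piece_disjoint[OF C D V] by blast
  fix x assume x: "x \<in> ?Q"
  have "{m. m < n \<and> x \<in> V m} = anc n"
  proof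
    show "anc n \<subseteq> {m. m < n \<and> x \<in> V m}" using x anc_less by auto
    show "{m. m < n \<and> x \<in> V m} \<subseteq> anc n" using x V by blast
  qed
  then show "x \<in> parity_set V n \<longleftrightarrow> odd (card (anc n))" by (simp add: parity_set_def)
qed

subsection \<open>The construction\<close>

lemma null_set_small_open_subset:
  fixes E :: "real set"
  assumes "E \<in> null_sets lebesgue" "open P" "e > 0"
  obtains V where "open V" "E \<inter> P \<subseteq> V" "V \<subseteq> P" "emeasure lebesgue V \<le> ennreal e"
proof -
  obtain W where W: "\<And>n. open (W n)" "\<And>n. E \<subseteq> W n" "antimono W"
    "\<And>n. emeasure lebesgue (W n) < ennreal (1 / Suc n)"
    using null_set_open_cover_antimono[OF assms(1)] by blast
  obtain n where n: "1 / Suc n < e"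
    using reals_Archimedean[OF assms(3)] by (auto simp: inverse_eq_divide)
  have "emeasure lebesgue (W n \<inter> P) \<le> emeasure lebesgue (W n)"
    using W(1) assms(2) by (intro emeasure_mono) auto
  also have "\<dots> \<le> ennreal e"
    using W(4)[of n] n by (meson ennreal_leI less_imp_le order_trans)
  finally show thesis
    using W(1,2)[of n] assms(2) by (intro that[of "W n \<inter> P"]) auto
qed

text \<open>The measure that may still change after node \<open>n\<close> has settled on the index
  \<open>N\<close>: times the kernel bound it is at most 1/(n+1). The summand 1 keeps the
  denominator positive when \<open>M N = 0\<close>.\<close>

definition tolerance :: "(nat \<Rightarrow> real) \<Rightarrow> nat \<Rightarrow> nat \<Rightarrow> real" where
  "tolerance M N n = 1 / (real (Suc n) * (\<bar>M N\<bar> + 1))"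

lemma tolerance_pos: "tolerance M N n > 0"
  by (simp add: tolerance_def zero_less_mult_iff add_nonneg_pos)

lemma mult_tolerance_le: "\<bar>M N\<bar> * tolerance M N n \<le> 1 / Suc n"
proof -
  have "\<bar>M N\<bar> / (\<bar>M N\<bar> + 1) \<le> 1" by simp
  then have "\<bar>M N\<bar> / (\<bar>M N\<bar> + 1) / Suc n \<le> 1 / Suc n" by (rule divide_right_mono) simp
  then show ?thesis by (simp add: tolerance_def field_simps)
qed

text \<open>Nodes are treated in numerical order. The index \<open>N n\<close> is fixed first, from
  the stage so far; then \<open>V n\<close> is made thin compared with the tolerances of node
  \<open>n\<close> and all earlier nodes. The factors \<open>(1/2) ^ Suc n\<close> make the flips
  from any node on, taken together, respect its tolerance.\<close>

lemma nested_flip_sequence: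
  assumes ab: "a < b" and K: "bounded_kernels K a b M"
    and L: "L_property K a b" "L_property_at_endpoints_in E K a b"
    and E: "E \<in> null_sets lebesgue"
    and U: "open U" "bounded U" "\<And>x. x \<in> U \<Longrightarrow> x = a \<or> x = b \<Longrightarrow> x \<in> E"
    and C: "\<And>V. open V \<Longrightarrow> bounded V \<Longrightarrow> (\<forall>j. compact (C V j) \<and> C V j \<subseteq> V) \<and>
      (\<forall>i j. i \<noteq> j \<longrightarrow> C V i \<inter> C V j = {})"
  obtains V N where
    "\<And>n. open (V n)" "\<And>n. V n \<subseteq> U"
    "\<And>n. E \<inter> interior (piece C U V n) \<subseteq> V n"
    "\<And>n. n \<le> N n"
    "\<And>n x. n > 0 \<Longrightarrow> x \<in> piece C U V n \<inter> {a..b} \<Longrightarrow>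
       \<bar>kernel_op K a b (N n) (indicator (parity_set V n)) x - of_bool (odd (card (anc n)))\<bar> < 1 / Suc n"
    "\<And>m n. m \<le> n \<Longrightarrow> emeasure lebesgue (V n) \<le> ennreal (tolerance M (N m) m * (1/2) ^ Suc n)"
proof -
  \<comment> \<open>At the root nothing is approximated, because its piece \<open>U\<close> is open
    rather than compact. The bound \<open>n \<le> N\<close> sends the indices to infinity.\<close>
  define near where "near A H n N \<longleftrightarrow> n \<le> N \<and> (n > 0 \<longrightarrow> (\<forall>x\<in>A \<inter> {a..b}.
      \<bar>kernel_op K a b N (indicator H) x - of_bool (odd (card (anc n)))\<bar> < 1 / Suc n))"
    for A H n N
  define P where "P f n r \<longleftrightarrow>
      open (fst r) \<and> E \<inter> interior (piece C U (fst \<circ> f) n) \<subseteq> fst r \<and> fst r \<subseteq> piece C U (fst \<circ> f) n \<and>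
      fst r \<subseteq> U \<and> near (piece C U (fst \<circ> f) n) (parity_set (fst \<circ> f) n) n (snd r) \<and>
      emeasure lebesgue (fst r) \<le> ennreal (tolerance M (snd r) n * (1/2) ^ Suc n) \<and>
      (\<forall>m<n. emeasure lebesgue (fst r) \<le> ennreal (tolerance M (snd (f m)) m * (1/2) ^ Suc n))"
    for f :: "nat \<Rightarrow> real set \<times> nat" and n r
  have "\<exists>f. \<forall>n. P f n (f n)"
  proof (rule dependent_wellorder_choice)
    fix r and f g :: "nat \<Rightarrow> real set \<times> nat" and n
    assume *: "\<And>m. m < n \<Longrightarrow> f m = g m"
    then have "parity_set (fst \<circ> f) n = parity_set (fst \<circ> g) n" "piece C U (fst \<circ> f) n = piece C U (fst \<circ> g) n"
      by (auto intro!: parity_set_cong piece_cong)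
    with * show "P f n r = P g n r" unfolding P_def by simp
  next
    fix n and f :: "nat \<Rightarrow> real set \<times> nat"
    assume IH: "\<And>m. m < n \<Longrightarrow> P f m (f m)"
    define V where "V = fst \<circ> f"
    have V: "open (V m)" "V m \<subseteq> piece C U V m" "V m \<subseteq> U" if "m < n" for m
      using IH[OF that] unfolding P_def V_def comp_def by auto
    have bV: "bounded (V m)" if "m < n" for m using bounded_subset[OF U(2) V(3)[OF that]] .
    let ?A = "piece C U V n"
    have "\<exists>N. near ?A (parity_set V n) n N"
    proof (cases "n > 0")
      case True
      obtain Q where Q: "open Q" "?A \<subseteq> Q" "\<And>x. x \<in> Q \<Longrightarrow> x \<in> parity_set V n \<longleftrightarrow> odd (card (anc n))"
        by (rule piece_neighbourhood[of n C V U]) (use C V bV True in auto)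
      obtain k where k: "n = Suc k" using True by (cases n) auto
      have kn: "fst (prod_decode k) < n" using fst_prod_decode_le[of k] k by simp
      have A: "compact ?A" "?A \<subseteq> U"
        using C[OF V(1) bV, OF kn kn] V(3)[OF kn] k by auto
      have S: "parity_set V n \<in> sets lebesgue"
        using parity_set_borel[of n V] V(1) by auto
      have "uniform_limit (?A \<inter> {a..b}) (\<lambda>N. kernel_op K a b N (indicator (parity_set V n)))
          (\<lambda>x. of_bool (odd (card (anc n)))) sequentially"
        using A U(3) by (intro localization_indicator[OF ab K L A(1) _ Q(1,2) S Q(3)]) auto
      then have "\<forall>\<^sub>F N in sequentially. \<forall>x\<in>?A \<inter> {a..b}.
         dist (kernel_op K a b N (indicator (parity_set V n)) x) (of_bool (odd (card (anc n)))) < 1 / Suc n"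
        by (rule uniform_limitD) simp
      then have "\<forall>\<^sub>F N in sequentially. n \<le> N \<and> (\<forall>x\<in>?A \<inter> {a..b}.
         dist (kernel_op K a b N (indicator (parity_set V n)) x) (of_bool (odd (card (anc n)))) < 1 / Suc n)"
        using eventually_ge_at_top[of n] by (simp add: eventually_conj)
      then have "\<forall>\<^sub>F N in sequentially. near ?A (parity_set V n) n N"
        by (simp only: near_def dist_real_def) (auto elim: eventually_mono)
      then show ?thesis using eventually_happens'[OF sequentially_bot] by blast
    qed (auto simp: near_def)
    then obtain N where N: "near ?A (parity_set V n) n N" by blast
    \<comment> \<open>The new flip set must respect its own tolerance and those of all earlier
      nodes: finitely many positive numbers.\<close>
    define e where "e = Min (insert (tolerance M N n) ((\<lambda>m. tolerance M (snd (f m)) m) ` {..<n}))"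
    have e: "e > 0" "e \<le> tolerance M N n" "\<And>m. m < n \<Longrightarrow> e \<le> tolerance M (snd (f m)) m"
      unfolding e_def using tolerance_pos by (auto intro!: Min_le)
    have "e * (1/2) ^ Suc n > 0" using e by simp
    then obtain Z where Z: "open Z" "E \<inter> (interior ?A \<inter> U) \<subseteq> Z" "Z \<subseteq> interior ?A \<inter> U"
      "emeasure lebesgue Z \<le> ennreal (e * (1/2) ^ Suc n)"
      using null_set_small_open_subset[OF E, of "interior ?A \<inter> U"] U(1) by (metis open_Int open_interior)
    have AU: "?A \<subseteq> U"
    proof (cases n)
      case (Suc k)
      then have kn: "fst (prod_decode k) < n" using fst_prod_decode_le[of k] by simp
      then show ?thesis using C[OF V(1) bV, OF kn kn] V(3)[OF kn] Suc by auto
    qed simp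
    have "P f n (Z, N)"
      unfolding P_def V_def[symmetric] fst_conv snd_conv
    proof (intro conjI allI impI)
      show "E \<inter> interior ?A \<subseteq> Z" using Z(2) AU interior_subset by blast
      show "Z \<subseteq> ?A" using Z(3) interior_subset by blast
      show "emeasure lebesgue Z \<le> ennreal (tolerance M N n * (1/2) ^ Suc n)"
        using Z(4) e(2) by (meson ennreal_leI mult_right_mono order_trans zero_le_power zero_le_divide_1_iff zero_le_numeral)
      show "emeasure lebesgue Z \<le> ennreal (tolerance M (snd (f m)) m * (1/2) ^ Suc n)" if "m < n" for m
        using Z(4) e(3)[OF that] by (meson ennreal_leI mult_right_mono order_trans zero_le_power zero_le_divide_1_iff zero_le_numeral)
    qed (use Z N in auto)
    then show "\<exists>r. P f n r" by blast
  qed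
  then obtain f where f: "\<And>n. P f n (f n)" by blast
  show thesis
  proof
    show "emeasure lebesgue ((fst \<circ> f) n) \<le> ennreal (tolerance M ((snd \<circ> f) m) m * (1/2) ^ Suc n)"
      if "m \<le> n" for m n
    proof (cases "m = n")
      case True
      then show ?thesis using f[of n, unfolded P_def] by (simp only: comp_apply)
    next
      case False
      with \<open>m \<le> n\<close> have "m < n" by simp
      then show ?thesis using f[of n, unfolded P_def] unfolding comp_apply by blast
    qed
  next
    fix n
    note fn = f[of n, unfolded P_def near_def]
    show "open ((fst \<circ> f) n)" "(fst \<circ> f) n \<subseteq> U" "E \<inter> interior (piece C U (fst \<circ> f) n) \<subseteq> (fst \<circ> f) n" "n \<le> (snd \<circ> f) n"
      using fn by auto
    show "\<bar>kernel_op K a b ((snd \<circ> f) n) (indicator (parity_set (fst \<circ> f) n)) x - of_bool (odd (card (anc n)))\<bar> < 1 / Suc n"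
      if "n > 0" "x \<in> piece C U (fst \<circ> f) n \<inter> {a..b}" for x
      using fn that unfolding comp_apply by blast
  qed
qed

section \<open>Passage to the lower and upper limits\<close>

lemma liminf_le_limsup_ge:
  fixes u :: "nat \<Rightarrow> real"
  assumes lo: "\<And>k. \<exists>n\<ge>k. u n \<le> l + 2 / Suc k"
    and hi: "\<And>k. \<exists>n\<ge>k. h - 2 / Suc k \<le> u n"
  shows "liminf (\<lambda>n. ereal (u n)) \<le> ereal l" "limsup (\<lambda>n. ereal (u n)) \<ge> ereal h"
proof -
  have small: "\<exists>k. k \<ge> n \<and> 2 / real (Suc k) < e" if e: "e > 0" for e :: real and n
  proof -
    obtain k where k: "1 / real (Suc k) < e / 2"
      using reals_Archimedean[of "e / 2"] e by (metis half_gt_zero inverse_eq_divide)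
    have "1 / real (Suc (max n k)) \<le> 1 / real (Suc k)" by (intro divide_left_mono) auto
    with k show ?thesis by (intro exI[of _ "max n k"]) auto
  qed
  show "liminf (\<lambda>n. ereal (u n)) \<le> ereal l"
  proof (rule ccontr)
    assume "\<not> ?thesis"
    then obtain c where c: "ereal l < ereal c" "ereal c < liminf (\<lambda>n. ereal (u n))"
      using ereal_dense2[of "ereal l"] by (auto simp: not_le)
    then have "\<forall>\<^sub>F n in sequentially. ereal c < ereal (u n)"
      using less_LiminfD by blast
    then obtain n where n: "\<And>m. m \<ge> n \<Longrightarrow> c < u m" by (auto simp: eventually_sequentially)
    obtain k where "k \<ge> n" "2 / real (Suc k) < c - l" using small[of "c - l" n] c by auto
    moreover obtain m where "m \<ge> k" "u m \<le> l + 2 / Suc k" using lo by blast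
    ultimately show False using n[of m] by linarith
  qed
  show "limsup (\<lambda>n. ereal (u n)) \<ge> ereal h"
  proof (rule ccontr)
    assume "\<not> ?thesis"
    then obtain c where c: "limsup (\<lambda>n. ereal (u n)) < ereal c" "ereal c < ereal h"
      using ereal_dense2[of _ "ereal h"] by (auto simp: not_le)
    then have "\<forall>\<^sub>F n in sequentially. ereal (u n) < ereal c"
      using Limsup_lessD by blast
    then obtain n where n: "\<And>m. m \<ge> n \<Longrightarrow> u m < c" by (auto simp: eventually_sequentially)
    obtain k where "k \<ge> n" "2 / real (Suc k) < h - c" using small[of "h - c" n] c by auto
    moreover obtain m where "m \<ge> k" "h - 2 / Suc k \<le> u m" using hi by blast
    ultimately show False using n[of m] by linarith
  qed
qed

theorem mainTheorem1:
  fixes K :: "nat \<Rightarrow> real \<Rightarrow> real \<Rightarrow> real" and M :: "nat \<Rightarrow> real"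
    and a b :: real and E :: "real set"
  assumes "a < b"
    and "bounded_kernels K a b M"
    and "L_property K a b"
    and "E \<subseteq> {a..b}" and "E \<in> null_sets lebesgue"
    and "L_property_at_endpoints_in E K a b"
  shows "\<exists>G. G \<subseteq> {a..b} \<and> G \<in> sets lebesgue \<and>
           (\<forall>x\<in>E. liminf (\<lambda>n. ereal (kernel_op K a b n (indicator G) x)) \<le> 0 \<and>
                   limsup (\<lambda>n. ereal (kernel_op K a b n (indicator G) x)) \<ge> 1)"
proof -
  \<comment> \<open>Localization at an endpoint is available only if it lies in \<open>E\<close>, so
    other endpoints are removed. \<open>U\<close> extends beyond [a,b] to contain endpoints in
    \<open>E\<close> as interior points.\<close>
  define U where "U = {a - 1<..<b + 1} - ({a, b} - E)"
  have U: "open U" "bounded U" "\<And>x. x \<in> U \<Longrightarrow> x = a \<or> x = b \<Longrightarrow> x \<in> E" "E \<subseteq> U"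
    using assms(4) unfolding U_def
    by (auto intro!: open_Diff finite_imp_closed intro: bounded_subset[OF bounded_box, of _ "a - 1" "b + 1"])
  define is_cover where "is_cover V C \<longleftrightarrow> (\<forall>j. compact (C j) \<and> C j \<subseteq> V) \<and>
      (\<forall>i j. i \<noteq> j \<longrightarrow> C i \<inter> C j = {}) \<and> E \<inter> V \<subseteq> (\<Union>j. interior (C j))"
    for V and C :: "nat \<Rightarrow> real set"
  define C where "C V = (SOME C. is_cover V C)" for V
  have C: "is_cover V (C V)" if "open V" "bounded V" for V
  proof -
    have "\<exists>C. is_cover V C" using disjoint_compact_cover[OF assms(5) that] unfolding is_cover_def .
    then show ?thesis unfolding C_def by (rule someI_ex)
  qed
  obtain V N where V: "\<And>n. open (V n)" "\<And>n. V n \<subseteq> U"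
    "\<And>n. E \<inter> interior (piece C U V n) \<subseteq> V n"
    and N: "\<And>n. n \<le> N n"
    "\<And>n x. n > 0 \<Longrightarrow> x \<in> piece C U V n \<inter> {a..b} \<Longrightarrow>
       \<bar>kernel_op K a b (N n) (indicator (parity_set V n)) x - of_bool (odd (card (anc n)))\<bar> < 1 / Suc n"
    and meas: "\<And>m n. m \<le> n \<Longrightarrow> emeasure lebesgue (V n) \<le> ennreal (tolerance M (N m) m * (1/2) ^ Suc n)"
    by (rule nested_flip_sequence[OF assms(1,2,3,6,5) U(1,2,3), of C])
      (use C in \<open>auto simp: is_cover_def\<close>)
  \<comment> \<open>A point changes sides exactly when it lies in the current flip set, so the
    stages converge at points of only finitely many \<open>V m\<close>. All other points lie in
    every tail union, and the measure of these unions tends to 0.\<close>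
  define G where "G = {a..b} \<inter> (\<Union>n. \<Inter>m\<in>{n..}. parity_set V m)"
  have H: "parity_set V n \<in> sets lebesgue" for n
    using parity_set_borel[of n V] V(1) by auto
  have G: "G \<in> sets lebesgue"
    unfolding G_def using H by (intro sets.Int sets.countable_UN sets.countable_INT'') auto
  have close: "\<bar>kernel_op K a b (N n) (indicator G) x - kernel_op K a b (N n) (indicator (parity_set V n)) x\<bar> \<le> 1 / Suc n"
    if x: "x \<in> {a..b}" for n x
  proof -
    define R where "R = (\<Union>m. V (n + m))"
    have stab: "t \<in> parity_set V m \<longleftrightarrow> t \<in> parity_set V n" if "t \<notin> R" "n \<le> m" for t m
      using that(2)
    proof (induction m rule: dec_induct)
      case (step m)
      have "t \<notin> V m" using that(1) step(1) by (metis R_def UN_I UNIV_I le_add_diff_inverse)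
      then show ?case using step by (auto simp: parity_set_Suc)
    qed simp
    have "t \<in> (\<Union>n. \<Inter>m\<in>{n..}. parity_set V m) \<longleftrightarrow> t \<in> parity_set V n" if "t \<notin> R" for t
    proof
      assume "t \<in> (\<Union>n. \<Inter>m\<in>{n..}. parity_set V m)"
      then obtain k where "\<forall>m\<in>{k..}. t \<in> parity_set V m" by blast
      then have "t \<in> parity_set V (max k n)" by simp
      then show "t \<in> parity_set V n" using stab[OF that, of "max k n"] by simp
    next
      assume "t \<in> parity_set V n"
      then have "\<forall>m\<in>{n..}. t \<in> parity_set V m" using stab[OF that] by blast
      then show "t \<in> (\<Union>n. \<Inter>m\<in>{n..}. parity_set V m)" by blast
    qed
    then have GH: "t \<in> G \<longleftrightarrow> t \<in> parity_set V n \<inter> {a..b}" if "t \<notin> R" for t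
      using that by (auto simp: G_def)
    let ?e = "tolerance M (N n) n"
    have "emeasure lebesgue R \<le> (\<Sum>m. emeasure lebesgue (V (n + m)))"
      unfolding R_def using V(1) by (intro emeasure_subadditive_countably) auto
    \<comment> \<open>Weakening the exponent \<open>Suc (n + m)\<close> to \<open>Suc m\<close>
      leaves a geometric series whose sum is exactly the tolerance.\<close>
    also have "\<dots> \<le> (\<Sum>m. ennreal (?e * (1/2) ^ Suc m))"
    proof (rule suminf_le)
      fix m
      have "emeasure lebesgue (V (n + m)) \<le> ennreal (?e * (1/2) ^ Suc (n + m))" by (rule meas) simp
      also have "\<dots> \<le> ennreal (?e * (1/2) ^ Suc m)"
        using tolerance_pos[of M "N n" n] by (intro ennreal_leI mult_left_mono power_decreasing) auto
      finally show "emeasure lebesgue (V (n + m)) \<le> ennreal (?e * (1/2) ^ Suc m)" .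
    qed auto
    also have "\<dots> = ennreal ?e"
      using sums_mult[OF power_half_series, of ?e] tolerance_pos[of M "N n" n]
      by (intro sums_unique[symmetric]) (simp add: sums_ennreal less_imp_le)
    finally have "emeasure lebesgue R \<le> ennreal ?e" .
    moreover have "R \<in> sets lebesgue" unfolding R_def using V(1) by auto
    ultimately have "\<bar>kernel_op K a b (N n) (indicator G) x - kernel_op K a b (N n) (indicator (parity_set V n \<inter> {a..b})) x\<bar> \<le> \<bar>M (N n)\<bar> * ?e"
      using tolerance_pos[of M "N n" n] GH H
      by (intro kernel_op_indicator_dist[OF assms(2) x G]) auto
    moreover have "kernel_op K a b (N n) (indicator (parity_set V n \<inter> {a..b})) x = kernel_op K a b (N n) (indicator (parity_set V n)) x"
      unfolding kernel_op_def by (intro Bochner_Integration.integral_cong) (auto simp: indicator_def)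
    ultimately show ?thesis using mult_tolerance_le[of M "N n" n] by simp
  qed
  \<comment> \<open>A point of \<open>E\<close> interior to a piece is in the flip set of its node,
    and the cover of that set puts it in the interior of a child's piece. So every depth is
    reached.\<close>
  have visit: "\<exists>n. card (anc n) = k \<and> x \<in> interior (piece C U V n)" if "x \<in> E" for x k
  proof (induction k)
    case 0
    have "x \<in> interior (piece C U V 0)" using U(1,4) that by (auto simp: interior_open)
    then show ?case by (intro exI[of _ 0]) auto
  next
    case (Suc k)
    then obtain n where n: "card (anc n) = k" "x \<in> interior (piece C U V n)" by blast
    then have "x \<in> E \<inter> V n" using V(3) that by blast
    moreover have "is_cover (V n) (C (V n))" using V(1) bounded_subset[OF U(2) V(2)] by (rule C)
    ultimately obtain j where "x \<in> interior (C (V n) j)" by (auto simp: is_cover_def)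
    then show ?case using n card_anc_Suc[of n j] by (intro exI[of _ "Suc (prod_encode (n, j))"]) auto
  qed
  \<comment> \<open>One error 1/(n+1) comes from the stage, another from the later flips. The
    witness is \<open>N n\<close>, at least \<open>k\<close> because a node's number is at least its
    depth; \<open>k > 0\<close> excludes the root.\<close>
  have near: "\<exists>n\<ge>k. \<bar>kernel_op K a b n (indicator G) x - of_bool (odd k)\<bar> \<le> 2 / Suc k" if "x \<in> E" "k > 0" for x k
  proof -
    obtain n where n: "card (anc n) = k" "x \<in> interior (piece C U V n)" using visit[OF \<open>x \<in> E\<close>] by blast
    have kn: "k \<le> n" using card_anc_le[of n] n by simp
    have "x \<in> piece C U V n \<inter> {a..b}" using n interior_subset that assms(4) by blast
    then have "\<bar>kernel_op K a b (N n) (indicator G) x - of_bool (odd k)\<bar> \<le> 2 / Suc n"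
      using N(2)[of n x] close[of x n] n kn that by auto
    also have "\<dots> \<le> 2 / Suc k" using kn by (simp add: frac_le)
    finally show ?thesis using N(1)[of n] kn by (meson order_trans)
  qed
  have "\<exists>n\<ge>k. kernel_op K a b n (indicator G) x \<le> 0 + 2 / Suc k"
    "\<exists>n\<ge>k. 1 - 2 / Suc k \<le> kernel_op K a b n (indicator G) x" if xE: "x \<in> E" for x k
  proof -
    \<comment> \<open>Even depths give values near 0, odd ones near 1. The depth 2k+2 replaces 2k
      because it must be positive also for k = 0.\<close>
    have "2 / real (Suc (2 * k + 2)) \<le> 2 / Suc k" "2 / real (Suc (2 * k + 1)) \<le> 2 / Suc k"
      by (auto intro!: divide_left_mono)
    moreover obtain n where "n \<ge> 2 * k + 2" "\<bar>kernel_op K a b n (indicator G) x\<bar> \<le> 2 / real (Suc (2 * k + 2))"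
      using near[OF xE, of "2 * k + 2"] by auto
    moreover obtain m where "m \<ge> 2 * k + 1" "\<bar>kernel_op K a b m (indicator G) x - 1\<bar> \<le> 2 / real (Suc (2 * k + 1))"
      using near[OF xE, of "2 * k + 1"] by auto
    ultimately have "n \<ge> k \<and> kernel_op K a b n (indicator G) x \<le> 0 + 2 / Suc k"
      "m \<ge> k \<and> 1 - 2 / Suc k \<le> kernel_op K a b m (indicator G) x"
      by linarith+
    then show "\<exists>n\<ge>k. kernel_op K a b n (indicator G) x \<le> 0 + 2 / Suc k"
      "\<exists>n\<ge>k. 1 - 2 / Suc k \<le> kernel_op K a b n (indicator G) x"
      by blast+
  qed
  then have "liminf (\<lambda>n. ereal (kernel_op K a b n (indicator G) x)) \<le> ereal 0 \<and>
      limsup (\<lambda>n. ereal (kernel_op K a b n (indicator G) x)) \<ge> ereal 1" if "x \<in> E" for x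
    using liminf_le_limsup_ge[of "\<lambda>n. kernel_op K a b n (indicator G) x" 0 1] that by blast
  moreover have "G \<subseteq> {a..b}" by (simp add: G_def)
  ultimately show ?thesis using G by (auto simp: zero_ereal_def one_ereal_def)
qed

end
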